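(* Let $$M(X,Y,A,B)=\sum_{n=1}^\infty X^n\sum_{\alpha,\beta\in\mathrm{Int}(n)}Y^{\|\alpha^{-1}\beta\|}A^{\|\alpha\|}B^{\|\beta\|}$$ and $$K(X,Y,A,B)=\sum_{n=1}^\infty X^n\sum_{\substack{\alpha,\beta\in\mathrm{KrInt}(n)\\ \alpha\wedge_{\mathrm{KrInt}}\beta=0_n}}Y^{\|\alpha^{-1}\beta\|}A^{\|\alpha^{-1}\gamma_n\|}B^{\|\beta^{-1}\gamma_n\|}.$$ Then $$M(X,Y,A,B)=\frac{X}{1-X(1+AB+(A+B)Y)},\qquad K(X,Y,A,B)=\frac{X}{1-X(AB+(A+B)Y)}.$$
   Context: $\mathcal S_n$ is the symmetric group on $[n]$; $\#\alpha$ is the number of cycles of $\alpha$ and $\|\alpha\|=n-\#\alpha$. $\gamma_n=(1\,2\,\cdots\,n)$ is the full cycle and $0_n$ the identity. $\mathrm{NC}(n)$ is the set of non-crossing partitions of $[n]$, each identified with the permutation whose cycles are its blocks with elements in increasing order; $\mathrm{Int}(n)\subseteq\mathrm{NC}(n)$ is the set of interval partitions (blocks of consecutive integers). $\mathrm{NC}(n)$ is ordered by $\rho\le\sigma$ iff each block of $\rho$ lies in a block of $\sigma$. The Kreweras complement of $\alpha\in\mathrm{NC}(n)$ is $\alpha^{\mathrm{Kr}}=\alpha^{-1}\gamma_n\in\mathrm{NC}(n)$, and $\mathrm{KrInt}(n)=\{\alpha^{\mathrm{Kr}}:\alpha\in\mathrm{Int}(n)\}$. For $\alpha,\beta\in\mathrm{NC}(n)$,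 $\alpha\wedge_{\mathrm{KrInt}}\beta=\max\{\rho\in\mathrm{KrInt}(n):\rho\le\alpha,\rho\le\beta\}$. *)

theory Defs
  imports
    "HOL-Computational_Algebra.Formal_Power_Series"
    "HOL-Combinatorics.Orbits"
    "HOL-Library.Disjoint_Sets"
begin

text \<open>Permutations of \<open>[n] = {1..n}\<close> are functions on \<open>nat\<close> that fix everything outside
  \<open>{1..n}\<close>, as in \<open>(permutes)\<close>; in particular \<open>0\<^sub>n\<close> is \<open>id\<close>.
  Products are read from right to left, i.e. as composition of functions.\<close>

text \<open>The cycles include the fixed points in \<open>{1..n}\<close> as singletons.\<close>

definition cycles_on :: "nat \<Rightarrow> (nat \<Rightarrow> nat) \<Rightarrow> nat set set" where
  "cycles_on n \<alpha> = orbit \<alpha> ` {1..n}"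

definition num_cycles :: "nat \<Rightarrow> (nat \<Rightarrow> nat) \<Rightarrow> nat" where
  "num_cycles n \<alpha> = card (cycles_on n \<alpha>)"

definition perm_len :: "nat \<Rightarrow> (nat \<Rightarrow> nat) \<Rightarrow> nat" where
  "perm_len n \<alpha> = n - num_cycles n \<alpha>"

definition full_cycle :: "nat \<Rightarrow> nat \<Rightarrow> nat" where
  "full_cycle n i = (if i \<in> {1..<n} then i + 1 else if i = n then 1 else i)"

definition noncrossing_partition :: "nat \<Rightarrow> nat set set \<Rightarrow> bool" where
  "noncrossing_partition n P \<longleftrightarrow> partition_on {1..n} P \<and>
     (\<forall>U\<in>P. \<forall>V\<in>P. \<forall>a b c d. a < b \<and> b < c \<and> c < d \<and> a \<in> U \<and> c \<in> U \<and> b \<in> V \<and> d \<in> V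
        \<longrightarrow> U = V)"

definition interval_partition :: "nat \<Rightarrow> nat set set \<Rightarrow> bool" where
  "interval_partition n P \<longleftrightarrow> noncrossing_partition n P \<and> (\<forall>U\<in>P. \<exists>a b. U = {a..b})"

text \<open>The permutation whose cycles are the blocks of \<open>P\<close> with elements in increasing order:
  each \<open>i\<close> goes to the next larger element of its block \<open>U\<close>, the largest one to \<open>Min U\<close>.\<close>

definition perm_of_partition :: "nat set set \<Rightarrow> nat \<Rightarrow> nat" where
  "perm_of_partition P i =
     (if i \<in> \<Union>P then
        let U = (THE U. U \<in> P \<and> i \<in> U)
        in if \<exists>j\<in>U. i < j then Min {j\<in>U. i < j} else Min U
      else i)"

definition IntNC :: "nat \<Rightarrow> (nat \<Rightarrow> nat) set" where
  "IntNC n = perm_of_partition ` {P. interval_partition n P}"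

definition NC_le :: "nat \<Rightarrow> (nat \<Rightarrow> nat) \<Rightarrow> (nat \<Rightarrow> nat) \<Rightarrow> bool" where
  "NC_le n \<rho> \<sigma> \<longleftrightarrow> refines {1..n} (cycles_on n \<rho>) (cycles_on n \<sigma>)"

definition kreweras :: "nat \<Rightarrow> (nat \<Rightarrow> nat) \<Rightarrow> nat \<Rightarrow> nat" where
  "kreweras n \<alpha> = inv \<alpha> \<circ> full_cycle n"

definition KrInt :: "nat \<Rightarrow> (nat \<Rightarrow> nat) set" where
  "KrInt n = kreweras n ` IntNC n"

text \<open>The maximum is the greatest element with respect to \<^const>\<open>NC_le\<close>.\<close>

definition meet_KrInt :: "nat \<Rightarrow> (nat \<Rightarrow> nat) \<Rightarrow> (nat \<Rightarrow> nat) \<Rightarrow> nat \<Rightarrow> nat" where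
  "meet_KrInt n \<alpha> \<beta> =
     (let S = {\<rho> \<in> KrInt n. NC_le n \<rho> \<alpha> \<and> NC_le n \<rho> \<beta>}
      in THE \<mu>. \<mu> \<in> S \<and> (\<forall>\<rho>\<in>S. NC_le n \<rho> \<mu>))"

text \<open>The generating functions are power series in \<open>X\<close>. Their coefficients are polynomials in
  \<open>Y\<close>, \<open>A\<close>, \<open>B\<close>, which may be any elements of a commutative ring, e.g. indeterminates.\<close>

definition M_gf :: "'a::comm_ring_1 \<Rightarrow> 'a \<Rightarrow> 'a \<Rightarrow> 'a fps" where
  "M_gf Y A B = Abs_fps (\<lambda>n. if n = 0 then 0 else
     (\<Sum>(\<alpha>, \<beta>) \<in> IntNC n \<times> IntNC n.
        Y ^ perm_len n (inv \<alpha> \<circ> \<beta>) * A ^ perm_len n \<alpha> * B ^ perm_len n \<beta>))"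

definition K_gf :: "'a::comm_ring_1 \<Rightarrow> 'a \<Rightarrow> 'a \<Rightarrow> 'a fps" where
  "K_gf Y A B = Abs_fps (\<lambda>n. if n = 0 then 0 else
     (\<Sum>(\<alpha>, \<beta>) \<in> {(\<alpha>, \<beta>). \<alpha> \<in> KrInt n \<and> \<beta> \<in> KrInt n \<and> meet_KrInt n \<alpha> \<beta> = id}.
        Y ^ perm_len n (inv \<alpha> \<circ> \<beta>) * A ^ perm_len n (inv \<alpha> \<circ> full_cycle n)
          * B ^ perm_len n (inv \<beta> \<circ> full_cycle n)))"

end

theory Submission
  imports Defs
begin

text \<open>An interval partition of \<open>[n]\<close> is determined by the set \<open>J \<subseteq> {1..<n}\<close> of those \<open>i\<close> that share
  a block with \<open>i + 1\<close>, and its permutation \<open>p\<^sub>J\<close> is the product, in increasing order, of the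
  transpositions \<open>(j j+1)\<close> for \<open>j \<in> J\<close>. Peeling off the largest transposition shows by induction on
  \<open>n\<close> that \<open>p\<^sub>J\<inverse> p\<^sub>K\<close> has length \<open>\<bar>J \<triangle> K\<bar>\<close>. Hence each of the \<open>n - 1\<close> positions contributes to
  \<open>M\<close> independently: \<open>1\<close>, \<open>A Y\<close>, \<open>B Y\<close> or \<open>A B\<close>, according to its membership in \<open>J\<close> and \<open>K\<close>.

  The Kreweras complement of \<open>p\<^sub>J\<close> fixes \<open>J\<close> and permutes \<open>[n] - J\<close> cyclically. So the
  order on Kreweras complements is reverse inclusion, the meet of those of \<open>p\<^sub>J\<close> and \<open>p\<^sub>K\<close> is that of
  \<open>p\<^bsub>J \<union> K\<^esub>\<close>, and it is trivial iff \<open>J \<union> K = {1..<n}\<close>. This removes the summand \<open>1\<close>.\<close>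


section \<open>Counting cycles\<close>

lemma permutes_self_in_orbit:
  assumes "f permutes S" "finite S"
  shows "x \<in> orbit f x"
proof (rule permutation_self_in_orbit)
  show "permutation f" using assms permutation_permutes by blast
qed

lemma permutes_orbit_eq:
  assumes "f permutes S" "finite S" "y \<in> orbit f x"
  shows "orbit f y = orbit f x"
  using cyclic_on_orbit[OF assms(1,2)] assms(3) by (rule orbit_cyclic_eq3)

lemma permutes_orbits_partition:
  assumes f: "f permutes S" "finite S"
  shows "partition_on S (orbit f ` S)"
proof (rule partition_onI)
  show "\<Union> (orbit f ` S) = S"
    using permutes_orbit_subset[OF f(1)] permutes_self_in_orbit[OF f] by blast
  show "{} \<notin> orbit f ` S"
    using orbit_nonempty by (metis imageE)
  show "disjnt p q" if "p \<in> orbit f ` S" "q \<in> orbit f ` S" "p \<noteq> q" for p q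
  proof -
    have "p = q" if "z \<in> p" "z \<in> q" for z
      using \<open>p \<in> _\<close> \<open>q \<in> _\<close> that permutes_orbit_eq[OF f, of z] by (elim imageE) metis
    with \<open>p \<noteq> q\<close> show ?thesis by (auto simp: disjnt_iff)
  qed
qed

text \<open>The bijection \<open>h\<close> carries the \<open>f\<close>-orbit of \<open>x\<close>
  onto the orbit of \<open>h x\<close> under the conjugate, so it matches cycles one to one.\<close>

lemma num_cycles_conj:
  assumes h: "h permutes {1..n}" and f: "f permutes {1..n}"
  shows "num_cycles n (h \<circ> f \<circ> inv h) = num_cycles n f"
proof -
  have "h ` orbit f x = orbit (h \<circ> f \<circ> inv h) (h x)" for x
    using permutes_self_in_orbit[OF f] permutes_inverses(2)[OF h]
    by (intro orbit_inverse) auto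
  then have "orbit (h \<circ> f \<circ> inv h) ` h ` {1..n} = (`) h ` orbit f ` {1..n}"
    by (simp add: image_image)
  then have "cycles_on n (h \<circ> f \<circ> inv h) = (`) h ` cycles_on n f"
    unfolding cycles_on_def permutes_image[OF h] .
  moreover have "inj_on ((`) h) (cycles_on n f)"
    using permutes_inj[OF h] by (simp add: inj_on_def inj_image_eq_iff)
  ultimately show ?thesis
    by (simp add: num_cycles_def card_image)
qed

text \<open>\<open>f \<circ> g\<close> is the conjugate of \<open>g \<circ> f\<close> by
  \<open>f\<close>.\<close>

lemma num_cycles_comp_commute:
  assumes f: "f permutes {1..n}" and g: "g permutes {1..n}"
  shows "num_cycles n (f \<circ> g) = num_cycles n (g \<circ> f)"
proof -
  have "f \<circ> g = f \<circ> (g \<circ> f) \<circ> inv f"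
    using permutes_inverses(1)[OF f] by (auto simp: fun_eq_iff)
  then show ?thesis
    using num_cycles_conj[OF f permutes_compose[OF f g]] by metis
qed

lemma num_cycles_Suc:
  assumes f: "f permutes {1..n}"
  shows "num_cycles (Suc n) f = Suc (num_cycles n f)"
proof -
  have fix_new: "f (Suc n) = Suc n"
    using permutes_not_in[OF f] by simp
  then have "orbit f (Suc n) = {Suc n}"
    by (simp add: orbit_eq_singleton_iff)
  then have "cycles_on (Suc n) f = insert {Suc n} (cycles_on n f)"
    by (simp add: cycles_on_def atLeastAtMostSuc_conv)
  moreover have "{Suc n} \<notin> cycles_on n f"
    using permutes_orbit_subset[OF f] by (fastforce simp: cycles_on_def)
  ultimately show ?thesis
    by (simp add: num_cycles_def cycles_on_def)
qed

text \<open>The transposition splices \<open>Suc n\<close> into the cycle of \<open>f\<close>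
  through \<open>n\<close>, directly after \<open>n\<close>; all other cycles stay as they
  are.\<close>

lemma num_cycles_comp_transpose:
  assumes f: "f permutes {1..n}" and n: "n \<ge> 1"
  shows "num_cycles (Suc n) (f \<circ> transpose n (Suc n)) = num_cycles n f"
proof -
  define g where "g = f \<circ> transpose n (Suc n)"
  \<comment> \<open>The effect on a single cycle; deleting \<open>Suc n\<close> undoes it.\<close>
  define ins where "ins C = (if n \<in> C then insert (Suc n) C else C)" for C
  have fix_new: "f (Suc n) = Suc n"
    using permutes_not_in[OF f] by simp
  have g_n: "g n = Suc n" and g_Suc: "g (Suc n) = f n"
    using fix_new by (auto simp: g_def transpose_def)
  have g_other: "g x = f x" if "x \<noteq> n" "x \<noteq> Suc n" for x
    using that by (simp add: g_def)
  have "transpose n (Suc n) permutes {1..Suc n}"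
    using n by (intro permutes_swap_id) auto
  moreover have "f permutes {1..Suc n}"
    using f by (rule permutes_subset) auto
  ultimately have g: "g permutes {1..Suc n}"
    unfolding g_def by (rule permutes_compose)
  have f_in: "x \<in> {1..n}" if "x \<in> orbit f y" "y \<in> {1..n}" for x y
    using permutes_orbit_subset[OF f] that by blast
  have orbit_g: "orbit g x = ins (orbit f x)" if x: "x \<in> {1..n}" for x
  proof (intro set_eqI iffI)
    fix y assume "y \<in> orbit g x"
    then show "y \<in> ins (orbit f x)"
    proof induction
      case base
      then show ?case
        using x g_n g_other orbit.base[of f x] permutes_self_in_orbit[OF f, of x]
        by (cases "x = n") (auto simp: ins_def g_n)
    next
      case (step y)
      consider "y = n" | "y = Suc n" | "y \<noteq> n" "y \<noteq> Suc n" by blast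
      then show ?case
      proof cases
        case 1
        with step show ?thesis by (auto simp: ins_def g_n split: if_splits)
      next
        case 2
        with step f_in[OF _ x, of "Suc n"] show ?thesis
          by (auto simp: ins_def g_Suc intro: orbit.step split: if_splits)
      next
        case 3
        with step show ?thesis
          by (auto simp: ins_def g_other intro: orbit.step split: if_splits)
      qed
    qed
  next
    \<comment> \<open>One step of \<open>f\<close> is one step of \<open>g\<close>, except at
      \<open>n\<close>, where \<open>g\<close> takes two steps because of the detour through
      \<open>Suc n\<close>.\<close>
    have g_f: "f y \<in> orbit g x" if "y \<in> orbit g x" "y \<noteq> Suc n" for y
    proof (cases "y = n")
      case True
      have "g (g y) \<in> orbit g x" using that by (intro orbit.step)
      then show ?thesis using True by (simp add: g_n g_Suc)
    next
      case False
      then show ?thesis using that g_other[of y] orbit.step[of y g x] by simp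
    qed
    have sub: "y \<in> orbit g x" if "y \<in> orbit f x" for y
      using that
    proof induction
      case base
      show ?case using g_f[of x] permutes_self_in_orbit[OF g, of x] x by simp
    next
      case (step y)
      then show ?case using g_f[of y] f_in[OF _ x, of y] by simp
    qed
    fix y assume "y \<in> ins (orbit f x)"
    then show "y \<in> orbit g x"
      using sub orbit.step[of n g x] by (auto simp: ins_def g_n split: if_splits)
  qed
  have "orbit g (Suc n) = orbit g n"
    using permutes_orbit_eq[OF g] orbit.base[of g n] by (simp add: g_n)
  then have "cycles_on (Suc n) g = orbit g ` {1..n}"
    using n by (auto simp: cycles_on_def atLeastAtMostSuc_conv)
  also have "\<dots> = ins ` cycles_on n f"
    using orbit_g by (simp add: cycles_on_def image_image)
  finally have "cycles_on (Suc n) g = ins ` cycles_on n f" .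
  moreover have "inj_on ins (cycles_on n f)"
  proof (rule inj_on_inverseI)
    fix C assume "C \<in> cycles_on n f"
    then have "Suc n \<notin> C"
      using f_in[of "Suc n"] by (force simp: cycles_on_def)
    then show "ins C - {Suc n} = C"
      by (auto simp: ins_def)
  qed
  ultimately show ?thesis
    by (simp add: num_cycles_def card_image g_def)
qed

section \<open>Interval permutations\<close>

text \<open>The least element of the block of \<open>i\<close>, found by walking down while the
  predecessor lies in \<open>J\<close>. If \<open>J \<subseteq> {1..<n}\<close>, then
  \<open>0\<close> is not in \<open>J\<close>, so a walk from a positive number ends at a positive
  number.\<close>

primrec block_start :: "nat set \<Rightarrow> nat \<Rightarrow> nat" where
  "block_start J 0 = 0"
| "block_start J (Suc i) = (if i \<in> J then block_start J i else Suc i)"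

text \<open>The permutation of the interval partition in which \<open>i\<close> and \<open>Suc i\<close> share a block
  iff \<open>i \<in> J\<close>.\<close>

definition join_perm :: "nat \<Rightarrow> nat set \<Rightarrow> nat \<Rightarrow> nat" where
  "join_perm n J i = (if i \<in> J then Suc i else if i \<in> {1..n} then block_start J i else i)"

lemma block_start_le: "block_start J i \<le> i"
  by (induction i) auto

lemma block_start_eqI:
  assumes "a \<le> i" "{a..<i} \<subseteq> J" "a \<noteq> 0 \<Longrightarrow> a - 1 \<notin> J"
  shows "block_start J i = a"
  using assms
proof (induction i)
  case (Suc i)
  show ?case
  proof (cases "a = Suc i")
    case True
    then show ?thesis using Suc.prems by simp
  next
    case False
    then have "a \<le> i" "i \<in> J" "{a..<i} \<subseteq> J"
      using Suc.prems by auto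
    then show ?thesis using Suc by simp
  qed
qed simp

lemma block_start_cong: "J \<inter> {..<i} = J' \<inter> {..<i} \<Longrightarrow> block_start J i = block_start J' i"
proof (induction i)
  case (Suc i)
  then have "J \<inter> {..<i} = J' \<inter> {..<i}" "i \<in> J \<longleftrightarrow> i \<in> J'" by (auto simp: set_eq_iff less_Suc_eq)
  with Suc show ?case by simp
qed simp

lemma join_perm_empty: "join_perm n {} = id"
proof
  show "join_perm n {} i = id i" for i
    by (cases i) (auto simp: join_perm_def)
qed

lemma join_perm_Suc:
  assumes "J \<subseteq> {1..<n}"
  shows "join_perm (Suc n) J = join_perm n J"
proof
  have "Suc n \<notin> J" "n \<notin> J" using assms by auto
  then show "join_perm (Suc n) J i = join_perm n J i" for i
    by (cases "i = Suc n") (auto simp: join_perm_def)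
qed

text \<open>\<open>Suc n\<close> is appended to the block ending in \<open>n\<close>: the
  transposition acts first, so \<open>n\<close> goes to the fixed point \<open>Suc n\<close>, while
  \<open>Suc n\<close> goes to \<open>n\<close> and from there to the start of the block.\<close>

lemma join_perm_insert:
  assumes J: "J \<subseteq> {1..<n}" and n: "n \<ge> 1"
  shows "join_perm (Suc n) (insert n J) = join_perm n J \<circ> transpose n (Suc n)"
proof
  fix i
  have notin: "Suc n \<notin> J" "n \<notin> J" using J by auto
  have start: "block_start (insert n J) i = block_start J i" if "i \<le> n" for i
    using that by (intro block_start_cong) auto
  consider "i < n" | "i = n" | "i = Suc n" | "i > Suc n" by linarith
  then show "join_perm (Suc n) (insert n J) i = (join_perm n J \<circ> transpose n (Suc n)) i"
    using notin n J by cases (auto simp: join_perm_def transpose_def start)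
qed

lemma join_perm_permutes:
  assumes "J \<subseteq> {1..<n}"
  shows "join_perm n J permutes {1..n}"
  using assms
proof (induction n arbitrary: J)
  case 0
  then show ?case by (simp add: join_perm_empty permutes_id del: id_apply)
next
  case (Suc n)
  define J' where "J' = J - {n}"
  have J': "J' \<subseteq> {1..<n}" using Suc.prems by (auto simp: J'_def)
  have p: "join_perm n J' permutes {1..Suc n}"
    using Suc.IH[OF J'] by (rule permutes_subset) auto
  show ?case
  proof (cases "n \<in> J")
    case True
    then have "J = insert n J'" "n \<ge> 1" using Suc.prems by (auto simp: J'_def)
    moreover from this have "transpose n (Suc n) permutes {1..Suc n}"
      by (intro permutes_swap_id) auto
    ultimately show ?thesis
      using join_perm_insert[OF J'] permutes_compose[OF _ p] by metis
  next
    case False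
    then show ?thesis
      using p join_perm_Suc[OF J'] by (simp add: J'_def)
  qed
qed

text \<open>Recovers \<open>J\<close> from its permutation: a block start never exceeds
  \<open>i\<close>, so only membership in \<open>J\<close> can produce \<open>Suc i\<close>.\<close>

lemma join_perm_eq_Suc_iff:
  assumes "J \<subseteq> {1..<n}"
  shows "join_perm n J i = Suc i \<longleftrightarrow> i \<in> J"
  using block_start_le[of J i] by (auto simp: join_perm_def)

lemma inj_on_join_perm: "inj_on (join_perm n) (Pow {1..<n})"
proof (rule inj_onI)
  fix J J' assume "J \<in> Pow {1..<n}" "J' \<in> Pow {1..<n}" "join_perm n J = join_perm n J'"
  then have "i \<in> J \<longleftrightarrow> i \<in> J'" for i
    using join_perm_eq_Suc_iff[of J n i] join_perm_eq_Suc_iff[of J' n i] by auto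
  then show "J = J'" by blast
qed

lemma full_cycle_eq_join_perm:
  assumes "n \<ge> 1"
  shows "full_cycle n = join_perm n {1..<n}"
proof
  have "block_start {1..<n} n = 1"
    using assms by (intro block_start_eqI) auto
  then show "full_cycle n i = join_perm n {1..<n} i" for i
    using assms by (auto simp: full_cycle_def join_perm_def)
qed

text \<open>Induction on \<open>n\<close>, removing \<open>n\<close> from both sets. The additive
  form avoids truncated subtraction.\<close>

lemma num_cycles_join_perm_quotient:
  assumes "J \<subseteq> {1..<n}" "K \<subseteq> {1..<n}"
  shows "num_cycles n (inv (join_perm n J) \<circ> join_perm n K) + card (sym_diff J K) = n"
  using assms
proof (induction n arbitrary: J K)
  case 0
  then show ?case by (simp add: num_cycles_def cycles_on_def)
next
  case (Suc n)
  define J' K' where "J' = J - {n}" and "K' = K - {n}"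
  define s where "s = transpose n (Suc n)"
  define p where "p = join_perm n J'"
  define q where "q = join_perm n K'"
  have J': "J' \<subseteq> {1..<n}" and K': "K' \<subseteq> {1..<n}"
    using Suc.prems by (auto simp: J'_def K'_def)
  have fin: "finite J'" "finite K'" "n \<notin> J'" "n \<notin> K'"
    using J' K' finite_subset by auto
  have p: "p permutes {1..n}" and q: "q permutes {1..n}"
    unfolding p_def q_def using join_perm_permutes J' K' by auto
  have pq: "inv p \<circ> q permutes {1..n}"
    using permutes_compose[OF q permutes_inv[OF p]] .
  have pq': "inv p \<circ> q permutes {1..Suc n}"
    using pq by (rule permutes_subset) auto
  have ih: "num_cycles n (inv p \<circ> q) + card (sym_diff J' K') = n"
    unfolding p_def q_def by (rule Suc.IH[OF J' K'])
  have s: "s permutes {1..Suc n}" "n \<ge> 1" if "n \<in> J \<or> n \<in> K"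
    using that Suc.prems by (auto simp: s_def intro!: permutes_swap_id)
  have jJ: "join_perm (Suc n) J = (if n \<in> J then p \<circ> s else p)"
    using join_perm_insert[OF J'] join_perm_Suc[OF J'] Suc.prems
    by (auto simp: J'_def p_def s_def insert_absorb)
  have jK: "join_perm (Suc n) K = (if n \<in> K then q \<circ> s else q)"
    using join_perm_insert[OF K'] join_perm_Suc[OF K'] Suc.prems
    by (auto simp: K'_def q_def s_def insert_absorb)
  have inv_ps: "inv (p \<circ> s) = s \<circ> inv p"
    unfolding s_def using o_inv_distrib[OF permutes_bij[OF p] bij_transpose] by simp
  have inv_s: "inv s = s"
    by (simp add: s_def)
  \<comment> \<open>If \<open>n\<close> lies in neither set, \<open>Suc n\<close> is a new fixed
    point. If it lies in exactly one, a single factor \<open>s\<close> inserts \<open>Suc n\<close>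
    into an existing cycle while the symmetric difference gains \<open>n\<close>. If it lies in
    both, \<open>s\<close> conjugates the smaller quotient.\<close>
  consider "n \<notin> J" "n \<notin> K" | "n \<in> J" "n \<notin> K" | "n \<notin> J" "n \<in> K" | "n \<in> J" "n \<in> K" by blast
  then have "num_cycles (Suc n) (inv (if n \<in> J then p \<circ> s else p) \<circ> (if n \<in> K then q \<circ> s else q))
      + card (sym_diff J K) = Suc n"
  proof cases
    case 1
    then show ?thesis
      using ih num_cycles_Suc[OF pq] by (simp add: J'_def K'_def)
  next
    case 2
    then have "sym_diff J K = insert n (sym_diff J' K')"
      by (auto simp: J'_def K'_def)
    \<comment> \<open>The factor \<open>s\<close> stands on the left here and is moved to the right
      by cyclic invariance.\<close>
    moreover have "num_cycles (Suc n) (s \<circ> (inv p \<circ> q)) = num_cycles n (inv p \<circ> q)"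
      using num_cycles_comp_commute[OF s(1) pq'] num_cycles_comp_transpose[OF pq s(2)] 2
      by (simp add: s_def)
    ultimately show ?thesis
      using ih fin 2 by (simp add: inv_ps comp_assoc)
  next
    case 3
    then have "sym_diff J K = insert n (sym_diff J' K')"
      by (auto simp: J'_def K'_def)
    moreover have "num_cycles (Suc n) (inv p \<circ> q \<circ> s) = num_cycles n (inv p \<circ> q)"
      using num_cycles_comp_transpose[OF pq s(2)] 3 by (simp add: s_def)
    ultimately show ?thesis
      using ih fin 3 by (simp add: comp_assoc)
  next
    case 4
    then have "sym_diff J K = sym_diff J' K'"
      by (auto simp: J'_def K'_def)
    moreover have "num_cycles (Suc n) (s \<circ> (inv p \<circ> q) \<circ> inv s) = Suc (num_cycles n (inv p \<circ> q))"
      using num_cycles_conj[OF s(1) pq'] num_cycles_Suc[OF pq] 4 by simp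
    ultimately show ?thesis
      using ih 4 by (simp add: inv_ps inv_s comp_assoc)
  qed
  then show ?case unfolding jJ jK .
qed

section \<open>Interval partitions correspond to subsets of \<open>{1..<n}\<close>\<close>

definition joins :: "nat set set \<Rightarrow> nat set" where
  "joins P = {i. \<exists>U\<in>P. i \<in> U \<and> Suc i \<in> U}"

lemma joins_subset:
  assumes "partition_on {1..n} P"
  shows "joins P \<subseteq> {1..<n}"
proof
  fix i assume "i \<in> joins P"
  then have "i \<in> {1..n}" "Suc i \<in> {1..n}"
    using partition_onD1[OF assms] by (auto simp: joins_def)
  then show "i \<in> {1..<n}" by auto
qed

text \<open>An interval containing \<open>a\<close> and \<open>c\<close> contains every
  \<open>b\<close> between them, and distinct blocks are disjoint, so intervals cannot
  cross.\<close>

lemma interval_partition_iff: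
  "interval_partition n P \<longleftrightarrow> partition_on {1..n} P \<and> (\<forall>U\<in>P. \<exists>a b. U = {a..b})"
proof
  assume P: "partition_on {1..n} P \<and> (\<forall>U\<in>P. \<exists>a b. U = {a..b})"
  have eq: "U = V" if "U \<in> P" "V \<in> P" "a < b" "b < c" "a \<in> U" "c \<in> U" "b \<in> V" for U V a b c
  proof -
    obtain l r where "U = {l..r}" using P \<open>U \<in> P\<close> by blast
    then have "b \<in> U" using \<open>a \<in> U\<close> \<open>c \<in> U\<close> \<open>a < b\<close> \<open>b < c\<close> by simp
    moreover have "disjoint P" using P partition_onD2 by blast
    ultimately show ?thesis
      using disjointD[of P U V] \<open>U \<in> P\<close> \<open>V \<in> P\<close> \<open>b \<in> V\<close> by blast
  qed
  then show "interval_partition n P"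
    unfolding interval_partition_def noncrossing_partition_def
    using P by (intro conjI ballI allI impI; elim conjE; (rule eq; assumption)?) auto
qed (auto simp: interval_partition_def noncrossing_partition_def)

text \<open>In a block \<open>{a..b}\<close> the next larger element of \<open>i < b\<close> is
  \<open>Suc i\<close>, and \<open>b\<close> returns to the minimum \<open>a\<close>, which is where
  the downward walk of \<open>block_start\<close> stops.\<close>

lemma perm_of_partition_eq_join_perm:
  assumes P: "interval_partition n P"
  shows "perm_of_partition P = join_perm n (joins P)"
proof
  fix i
  have part: "partition_on {1..n} P" and int: "\<And>U. U \<in> P \<Longrightarrow> \<exists>a b. U = {a..b}"
    using P by (auto simp: interval_partition_iff)
  have uniq: "U = V" if "U \<in> P" "V \<in> P" "x \<in> U" "x \<in> V" for U V x
    using that partition_onD2[OF part] by (meson disjointD disjoint_iff)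
  have Un: "\<Union>P = {1..n}"
    using partition_onD1[OF part] by simp
  show "perm_of_partition P i = join_perm n (joins P) i"
  proof (cases "i \<in> {1..n}")
    case False
    moreover from this have "i \<notin> joins P"
      using joins_subset[OF part] by auto
    ultimately show ?thesis
      unfolding perm_of_partition_def join_perm_def Un by auto
  next
    case True
    then obtain U where U: "U \<in> P" "i \<in> U" using Un by blast
    then obtain a b where ab: "U = {a..b}" using int by blast
    have the_U: "(THE U. U \<in> P \<and> i \<in> U) = U"
    proof (rule the_equality)
      show "V = U" if "V \<in> P \<and> i \<in> V" for V
        by (rule uniq[OF _ U(1) _ U(2)]) (use that in simp_all)
    qed (use U in simp)
    have joins_iff: "x \<in> joins P \<longleftrightarrow> Suc x \<in> U" if "x \<in> U" for x
    proof
      assume "x \<in> joins P"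
      then obtain V where "V \<in> P" "x \<in> V" "Suc x \<in> V" by (auto simp: joins_def)
      then show "Suc x \<in> U" using uniq[OF _ U(1) _ that, of V] by simp
    qed (use that U(1) in \<open>auto simp: joins_def\<close>)
    have perm: "perm_of_partition P i = (if \<exists>j\<in>U. i < j then Min {j\<in>U. i < j} else Min U)"
      using True Un by (simp add: perm_of_partition_def the_U)
    show ?thesis
    proof (cases "i < b")
      case True
      then have "Suc i \<in> {j\<in>U. i < j}" using U ab by auto
      moreover from this have "Min {j\<in>U. i < j} = Suc i"
        using ab by (intro Min_eqI) auto
      ultimately show ?thesis
        using perm joins_iff[OF U(2)] by (auto simp: join_perm_def)
    next
      case False
      then have i: "i = b" "a \<le> i" using U ab by auto
      then have "perm_of_partition P i = Min U"
        using perm ab by auto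
      also have "Min U = a"
        using ab i by (intro Min_eqI) auto
      also have "a = block_start (joins P) i"
      proof (rule block_start_eqI[symmetric])
        show "{a..<i} \<subseteq> joins P"
          using joins_iff ab i by auto
        \<comment> \<open>Otherwise \<open>a - 1\<close> would share the block of \<open>a\<close>,
          below its minimum; \<open>a \<noteq> 0\<close> ensures
          \<open>Suc (a - 1) = a\<close>.\<close>
        show "a - 1 \<notin> joins P" if "a \<noteq> 0"
        proof
          assume "a - 1 \<in> joins P"
          then obtain V where "V \<in> P" "a - 1 \<in> V" "a \<in> V"
            using \<open>a \<noteq> 0\<close> by (auto simp: joins_def)
          moreover have "a \<in> U" using ab i by simp
          ultimately have "a - 1 \<in> U" using uniq[of V U a] U(1) by simp
          then show False using ab \<open>a \<noteq> 0\<close> by auto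
        qed
      qed (use i in simp)
      finally show ?thesis
        using joins_iff[OF U(2)] ab i True by (simp add: join_perm_def)
    qed
  qed
qed

lemma mono_block_start: "mono (block_start J)"
  unfolding mono_iff_le_Suc
proof
  show "block_start J i \<le> block_start J (Suc i)" for i
    using block_start_le[of J i] by simp
qed

text \<open>The blocks are the fibres of \<open>block_start J\<close>. Monotonicity makes them
  intervals, and as \<open>block_start J i \<le> i < Suc i\<close>, the starts of \<open>i\<close>
  and \<open>Suc i\<close> agree exactly when \<open>i \<in> J\<close>.\<close>

lemma ex_interval_partition_joins:
  assumes J: "J \<subseteq> {1..<n}"
  obtains P where "interval_partition n P" "joins P = J"
proof -
  define blk where "blk s = {i \<in> {1..n}. block_start J i = s}" for s
  define P where "P = blk ` block_start J ` {1..n}"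
  have "partition_on {1..n} P"
    by (rule partition_onI) (auto simp: P_def blk_def disjnt_iff)
  moreover have "\<exists>a b. U = {a..b}" if "U \<in> P" for U
  proof -
    obtain x where x: "x \<in> {1..n}" and Ux: "U = blk (block_start J x)"
      using \<open>U \<in> P\<close> by (auto simp: P_def)
    define s where "s = block_start J x"
    have U: "U = blk s" "U \<noteq> {}" "finite U"
      using x Ux by (auto simp: blk_def s_def)
    have "{Min U..Max U} \<subseteq> U"
    proof
      fix i assume i: "i \<in> {Min U..Max U}"
      have "Min U \<in> blk s" "Max U \<in> blk s"
        using U Min_in Max_in by auto
      moreover from i have "block_start J (Min U) \<le> block_start J i"
          "block_start J i \<le> block_start J (Max U)"
        using monoD[OF mono_block_start[of J]] by auto
      ultimately show "i \<in> U"
        using i by (auto simp: U blk_def)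
    qed
    moreover have "U \<subseteq> {Min U..Max U}"
      using U by auto
    ultimately show ?thesis by blast
  qed
  ultimately have "interval_partition n P"
    by (simp add: interval_partition_iff)
  moreover have "i \<in> joins P \<longleftrightarrow> i \<in> J" for i
  proof -
    have "i \<in> joins P \<longleftrightarrow> i \<in> {1..n} \<and> Suc i \<in> {1..n} \<and> block_start J i = block_start J (Suc i)"
      by (auto simp: joins_def P_def blk_def)
    also have "block_start J i = block_start J (Suc i) \<longleftrightarrow> i \<in> J"
      using block_start_le[of J i] by auto
    finally show ?thesis using J by auto
  qed
  ultimately show ?thesis using that by blast
qed

lemma IntNC_eq: "IntNC n = join_perm n ` Pow {1..<n}"
proof (intro set_eqI iffI)
  fix \<alpha> assume "\<alpha> \<in> IntNC n"
  then obtain P where P: "interval_partition n P" and \<alpha>: "\<alpha> = perm_of_partition P"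
    by (auto simp: IntNC_def)
  then have "joins P \<subseteq> {1..<n}"
    using joins_subset by (simp add: interval_partition_iff)
  then show "\<alpha> \<in> join_perm n ` Pow {1..<n}"
    using perm_of_partition_eq_join_perm[OF P] \<alpha> by auto
next
  fix \<alpha> assume "\<alpha> \<in> join_perm n ` Pow {1..<n}"
  then obtain J where "J \<subseteq> {1..<n}" and \<alpha>: "\<alpha> = join_perm n J" by auto
  from this(1) obtain P where "interval_partition n P" "joins P = J"
    by (rule ex_interval_partition_joins)
  then show "\<alpha> \<in> IntNC n"
    using perm_of_partition_eq_join_perm \<alpha> by (auto simp: IntNC_def)
qed

lemma perm_len_join_perm_quotient:
  assumes "J \<subseteq> {1..<n}" "K \<subseteq> {1..<n}"
  shows "perm_len n (inv (join_perm n J) \<circ> join_perm n K) = card (sym_diff J K)"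
  using num_cycles_join_perm_quotient[OF assms] by (simp add: perm_len_def)

lemma perm_len_join_perm:
  assumes "J \<subseteq> {1..<n}"
  shows "perm_len n (join_perm n J) = card J"
  using perm_len_join_perm_quotient[OF _ assms, of "{}"] by (simp add: join_perm_empty)

section \<open>Kreweras complements of interval partitions\<close>

lemma full_cycle_permutes: "n \<ge> 1 \<Longrightarrow> full_cycle n permutes {1..n}"
  using full_cycle_eq_join_perm[of n] join_perm_permutes[of "{1..<n}" n, OF subset_refl]
  by (simp only:)

lemma kreweras_permutes:
  assumes "n \<ge> 1" "J \<subseteq> {1..<n}"
  shows "kreweras n (join_perm n J) permutes {1..n}"
  unfolding kreweras_def
  using assms full_cycle_permutes join_perm_permutes by (intro permutes_compose permutes_inv)

text \<open>Exhibits the permutation in the exponents of \<open>A\<close> and \<open>B\<close> in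
  \<open>K_gf\<close> as a conjugate of the interval permutation, so that its length is again
  \<open>card J\<close>.\<close>

lemma inv_kreweras_comp_full_cycle:
  assumes "n \<ge> 1" "J \<subseteq> {1..<n}"
  shows "inv (kreweras n (join_perm n J)) \<circ> full_cycle n
    = inv (full_cycle n) \<circ> join_perm n J \<circ> full_cycle n"
proof -
  note p = permutes_bij[OF join_perm_permutes[OF assms(2)]]
  show ?thesis
    unfolding kreweras_def
    using permutes_bij[OF full_cycle_permutes[OF assms(1)]] p
    by (simp add: o_inv_distrib bij_imp_bij_inv inv_inv_eq)
qed

lemma perm_len_inv_kreweras_comp_full_cycle:
  assumes "n \<ge> 1" "J \<subseteq> {1..<n}"
  shows "perm_len n (inv (kreweras n (join_perm n J)) \<circ> full_cycle n) = card J"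
proof -
  note g = full_cycle_permutes[OF assms(1)]
  have "num_cycles n (inv (full_cycle n) \<circ> join_perm n J \<circ> full_cycle n)
      = num_cycles n (join_perm n J)"
    using num_cycles_conj[OF permutes_inv[OF g] join_perm_permutes[OF assms(2)]]
    by (simp add: inv_inv_eq[OF permutes_bij[OF g]])
  then show ?thesis
    unfolding inv_kreweras_comp_full_cycle[OF assms]
    using perm_len_join_perm[OF assms(2)] by (simp add: perm_len_def)
qed

text \<open>The outer factors \<open>g\<close> form a conjugation around
  \<open>p \<circ> inv q\<close>; cyclic invariance turns this into \<open>inv q \<circ> p\<close>,
  whose cycles are already counted.\<close>

lemma perm_len_kreweras_quotient:
  assumes n: "n \<ge> 1" and J: "J \<subseteq> {1..<n}" and K: "K \<subseteq> {1..<n}"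
  shows "perm_len n (inv (kreweras n (join_perm n J)) \<circ> kreweras n (join_perm n K))
    = card (sym_diff J K)"
proof -
  define g p q where "g = full_cycle n" and "p = join_perm n J" and "q = join_perm n K"
  have g: "g permutes {1..n}" and p: "p permutes {1..n}" and q: "q permutes {1..n}"
    using full_cycle_permutes[OF n] join_perm_permutes J K by (auto simp: g_def p_def q_def)
  have pq: "p \<circ> inv q permutes {1..n}"
    by (rule permutes_compose[OF permutes_inv[OF q] p])
  have "inv (kreweras n p) \<circ> kreweras n q = inv g \<circ> (p \<circ> inv q) \<circ> inv (inv g)"
    unfolding kreweras_def g_def[symmetric]
    using permutes_bij[OF g] permutes_bij[OF p]
    by (simp add: o_inv_distrib bij_imp_bij_inv inv_inv_eq comp_assoc)
  then have "num_cycles n (inv (kreweras n p) \<circ> kreweras n q) = num_cycles n (p \<circ> inv q)"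
    using num_cycles_conj[OF permutes_inv[OF g] pq] by simp
  also have "\<dots> = num_cycles n (inv q \<circ> p)"
    by (rule num_cycles_comp_commute[OF p permutes_inv[OF q]])
  finally show ?thesis
    using perm_len_join_perm_quotient[OF K J] by (simp add: perm_len_def p_def q_def Un_commute)
qed

text \<open>The elements of \<open>J\<close> are fixed points and there are \<open>card J + 1\<close> cycles in total, so all
  remaining elements lie in one cycle.\<close>

lemma cycles_on_kreweras:
  assumes n: "n \<ge> 1" and J: "J \<subseteq> {1..<n}"
  shows "cycles_on n (kreweras n (join_perm n J)) = insert ({1..n} - J) ((\<lambda>j. {j}) ` J)"
proof -
  define k where "k = kreweras n (join_perm n J)"
  define R where "R = {1..n} - J"
  have k: "k permutes {1..n}"
    unfolding k_def by (rule kreweras_permutes[OF n J])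
  have fin: "finite J" using J finite_subset by blast
  have "k j = j" if "j \<in> J" for j
  proof -
    \<comment> \<open>On \<open>J\<close> both permutations send \<open>j\<close> to
      \<open>Suc j\<close>, so the complement fixes \<open>j\<close>.\<close>
    have "full_cycle n j = join_perm n J j"
      using that J by (auto simp: full_cycle_def join_perm_def)
    then show ?thesis
      using permutes_inverses(2)[OF join_perm_permutes[OF J]] by (simp add: k_def kreweras_def)
  qed
  then have orbit_J: "orbit k j = {j}" if "j \<in> J" for j
    using that by (simp add: orbit_eq_singleton_iff)
  have orbit_R: "orbit k x \<subseteq> R" if "x \<in> R" for x
  proof
    fix y assume y: "y \<in> orbit k x"
    have "y \<in> {1..n}"
      using y permutes_orbit_subset[OF k, of x] that by (auto simp: R_def)
    moreover have "y \<notin> J"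
    proof
      assume "y \<in> J"
      then have "orbit k x = {y}"
        using permutes_orbit_eq[OF k _ y] orbit_J by simp
      then have "x = y"
        using permutes_self_in_orbit[OF k, of x] by simp
      then show False using \<open>y \<in> J\<close> that by (simp add: R_def)
    qed
    ultimately show "y \<in> R" by (simp add: R_def)
  qed
  have "J \<union> R = {1..n}"
    using J by (auto simp: R_def)
  then have cycles: "cycles_on n k = (\<lambda>j. {j}) ` J \<union> orbit k ` R"
    unfolding cycles_on_def \<open>J \<union> R = {1..n}\<close>[symmetric] image_Un using orbit_J by simp
  \<comment> \<open>The full cycle is the interval permutation of \<open>{1..<n}\<close>, so
    \<open>k\<close> is itself a quotient of two interval permutations.\<close>
  have "num_cycles n k + card (sym_diff J {1..<n}) = n"
    using num_cycles_join_perm_quotient[OF J subset_refl]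
    by (simp add: k_def kreweras_def full_cycle_eq_join_perm[OF n])
  moreover have "sym_diff J {1..<n} = {1..<n} - J"
    using J by auto
  then have "card (sym_diff J {1..<n}) = n - 1 - card J"
    using J fin by (simp add: card_Diff_subset)
  moreover have "card J \<le> n - 1"
    using card_mono[OF _ J] by simp
  ultimately have "num_cycles n k = card J + 1"
    using n by linarith
  moreover have "num_cycles n k = card J + card (orbit k ` R)"
  proof -
    have "(\<lambda>j. {j}) ` J \<inter> orbit k ` R = {}"
      using orbit_R by (fastforce simp: R_def)
    then show ?thesis
      unfolding num_cycles_def cycles
      by (subst card_Un_disjoint) (auto simp: fin R_def card_image)
  qed
  \<comment> \<open>Comparing the two counts leaves a single orbit for \<open>R\<close>, which must
    then be all of \<open>R\<close>.\<close>
  ultimately obtain C where C: "orbit k ` R = {C}"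
    by (auto simp: card_1_singleton_iff)
  moreover have "\<Union> (orbit k ` R) = R"
    using orbit_R permutes_self_in_orbit[OF k] by blast
  ultimately have "orbit k ` R = {R}" by simp
  then show ?thesis
    using cycles by (simp add: k_def R_def)
qed

section \<open>Order and meet on Kreweras complements of interval partitions\<close>

lemma NC_le_kreweras_iff:
  assumes n: "n \<ge> 1" and J: "J \<subseteq> {1..<n}" and L: "L \<subseteq> {1..<n}"
  shows "NC_le n (kreweras n (join_perm n L)) (kreweras n (join_perm n J)) \<longleftrightarrow> J \<subseteq> L"
proof -
  \<comment> \<open>\<open>refines\<close> also demands that both families be partitions.\<close>
  have part: "partition_on {1..n} (cycles_on n (kreweras n (join_perm n J)))"
    if "J \<subseteq> {1..<n}" for J
    unfolding cycles_on_def by (rule permutes_orbits_partition) (use kreweras_permutes n that in auto)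
  have "(\<forall>U\<in>insert ({1..n} - L) ((\<lambda>j. {j}) ` L). \<exists>V\<in>insert ({1..n} - J) ((\<lambda>j. {j}) ` J). U \<subseteq> V)
      \<longleftrightarrow> J \<subseteq> L" (is "?refines \<longleftrightarrow> _")
  proof
    assume ?refines
    then obtain V where V: "V \<in> insert ({1..n} - J) ((\<lambda>j. {j}) ` J)" "{1..n} - L \<subseteq> V"
      by (meson insertI1)
    \<comment> \<open>No index set contains \<open>n\<close>, so the block of \<open>n\<close> is
      the large one on both sides, which forces the complements to be nested.\<close>
    have "n \<in> {1..n} - L" "n \<notin> J"
      using L J n by auto
    then have "n \<in> V" using V(2) by blast
    then have "V = {1..n} - J"
      using V(1) \<open>n \<notin> J\<close> by blast
    moreover have "J \<subseteq> {1..n}"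
      using J by auto
    ultimately show "J \<subseteq> L"
      using V(2) by blast
  next
    assume "J \<subseteq> L"
    have "\<exists>V\<in>insert ({1..n} - J) ((\<lambda>j. {j}) ` J). {l} \<subseteq> V" if "l \<in> L" for l
      using that L by (cases "l \<in> J") auto
    moreover have "{1..n} - L \<subseteq> {1..n} - J"
      using \<open>J \<subseteq> L\<close> by blast
    ultimately show ?refines by simp
  qed
  then show ?thesis
    using part[OF J] part[OF L]
    unfolding NC_le_def refines_def cycles_on_kreweras[OF n J] cycles_on_kreweras[OF n L]
    by (simp only: simp_thms)
qed

text \<open>As the order is reversed inclusion of index sets, common lower bounds correspond to the
  supersets of \<open>J \<union> K\<close>, and the smallest superset gives the greatest
  bound.\<close>

lemma meet_KrInt_kreweras:
  assumes n: "n \<ge> 1" and J: "J \<subseteq> {1..<n}" and K: "K \<subseteq> {1..<n}"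
  shows "meet_KrInt n (kreweras n (join_perm n J)) (kreweras n (join_perm n K))
    = kreweras n (join_perm n (J \<union> K))"
proof -
  define kr where "kr L = kreweras n (join_perm n L)" for L
  have le: "NC_le n (kr L) (kr L') \<longleftrightarrow> L' \<subseteq> L" if "L \<subseteq> {1..<n}" "L' \<subseteq> {1..<n}" for L L'
    unfolding kr_def by (rule NC_le_kreweras_iff[OF n that(2,1)])
  have S: "{\<rho> \<in> KrInt n. NC_le n \<rho> (kr J) \<and> NC_le n \<rho> (kr K)} = kr ` {L. L \<subseteq> {1..<n} \<and> J \<union> K \<subseteq> L}"
    using le J K by (auto simp: KrInt_def IntNC_eq kr_def)
  have "(THE \<mu>. \<mu> \<in> kr ` {L. L \<subseteq> {1..<n} \<and> J \<union> K \<subseteq> L} \<and>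
      (\<forall>\<rho>\<in>kr ` {L. L \<subseteq> {1..<n} \<and> J \<union> K \<subseteq> L}. NC_le n \<rho> \<mu>)) = kr (J \<union> K)"
  proof (rule the_equality)
    show "kr (J \<union> K) \<in> kr ` {L. L \<subseteq> {1..<n} \<and> J \<union> K \<subseteq> L} \<and>
      (\<forall>\<rho>\<in>kr ` {L. L \<subseteq> {1..<n} \<and> J \<union> K \<subseteq> L}. NC_le n \<rho> (kr (J \<union> K)))"
      using J K le by auto
    fix \<mu> assume \<mu>: "\<mu> \<in> kr ` {L. L \<subseteq> {1..<n} \<and> J \<union> K \<subseteq> L} \<and>
      (\<forall>\<rho>\<in>kr ` {L. L \<subseteq> {1..<n} \<and> J \<union> K \<subseteq> L}. NC_le n \<rho> \<mu>)"
    then obtain L where L: "\<mu> = kr L" "L \<subseteq> {1..<n}" "J \<union> K \<subseteq> L" by blast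
    \<comment> \<open>\<open>kr (J \<union> K)\<close> is itself a common lower bound, so it lies
      below any greatest one; this yields \<open>L \<subseteq> J \<union> K\<close>.\<close>
    have "NC_le n (kr (J \<union> K)) (kr L)"
      using \<mu> J K L(1) by auto
    then have "L = J \<union> K"
      using le[of "J \<union> K" L] L J K by auto
    then show "\<mu> = kr (J \<union> K)" using L by simp
  qed
  then show ?thesis
    using S by (simp add: meet_KrInt_def Let_def kr_def)
qed

lemma kreweras_eq_id_iff:
  assumes n: "n \<ge> 1" and J: "J \<subseteq> {1..<n}"
  shows "kreweras n (join_perm n J) = id \<longleftrightarrow> J = {1..<n}"
proof -
  note p = permutes_bij[OF join_perm_permutes[OF J]]
  have "kreweras n (join_perm n J) = id \<longleftrightarrow> full_cycle n = join_perm n J"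
    unfolding kreweras_def
    using p by (metis bij_betw_def comp_assoc comp_id id_comp inv_o_cancel surj_iff)
  also have "\<dots> \<longleftrightarrow> {1..<n} = J"
    unfolding full_cycle_eq_join_perm[OF n]
    using inj_on_join_perm[of n] J by (auto simp: inj_on_eq_iff)
  finally show ?thesis by auto
qed

text \<open>By reflexivity, equal complements lie below each other, which gives both inclusions of
  the index sets.\<close>

lemma inj_on_kreweras_join_perm:
  assumes n: "n \<ge> 1"
  shows "inj_on (\<lambda>J. kreweras n (join_perm n J)) (Pow {1..<n})"
proof (rule inj_onI)
  fix J K assume "J \<in> Pow {1..<n}" "K \<in> Pow {1..<n}"
    "kreweras n (join_perm n J) = kreweras n (join_perm n K)"
  then show "J = K"
    using NC_le_kreweras_iff[OF n, of J K] NC_le_kreweras_iff[OF n, of K J]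
      NC_le_kreweras_iff[OF n, of J J] by auto
qed

section \<open>Summation\<close>

lemma sum_Pow_insert:
  assumes "finite S" "x \<notin> S"
  shows "(\<Sum>J\<in>Pow (insert x S). f J) = (\<Sum>J\<in>Pow S. f J + f (insert x J))"
proof -
  have "inj_on (insert x) (Pow S)"
    using assms(2) by (auto simp: inj_on_def insert_eq_iff)
  moreover have "Pow S \<inter> insert x ` Pow S = {}"
    using assms(2) by auto
  ultimately show ?thesis
    using assms(1) by (simp add: Pow_insert sum.union_disjoint sum.reindex sum.distrib)
qed

text \<open>For \<open>c = 0\<close> only the pairs with \<open>J \<union> K = S\<close> contribute, as \<open>0 ^ 0 = 1\<close>.\<close>

lemma sum_Pow_Pow:
  fixes c Y A B :: "'a::comm_ring_1" and S :: "'b set"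
  assumes "finite S"
  shows "(\<Sum>J\<in>Pow S. \<Sum>K\<in>Pow S. c ^ card (S - (J \<union> K)) *
      (Y ^ card (sym_diff J K) * A ^ card J * B ^ card K)) = (c + A * B + (A + B) * Y) ^ card S"
  using assms
proof (induction S)
  case empty
  then show ?case by simp
next
  case (insert x S)
  define w where "w S J K = c ^ card (S - (J \<union> K)) *
      (Y ^ card (sym_diff J K) * A ^ card J * B ^ card K)" for S J K :: "'b set"
  define q where "q = c + A * B + (A + B) * Y"
  \<comment> \<open>The summands place \<open>x\<close> in neither set, only in \<open>K\<close>,
    only in \<open>J\<close>, or in both, with factors \<open>c\<close>, \<open>B * Y\<close>,
    \<open>A * Y\<close> and \<open>A * B\<close>, which add up to \<open>q\<close>.\<close>
  have step: "w (insert x S) J K + w (insert x S) J (insert x K) +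
      (w (insert x S) (insert x J) K + w (insert x S) (insert x J) (insert x K)) = q * w S J K"
    if "J \<in> Pow S" "K \<in> Pow S" for J K
  proof -
    have fin: "finite J" "finite K" "x \<notin> J" "x \<notin> K"
      using that insert.hyps finite_subset by auto
    have sets: "insert x S - (J \<union> K) = insert x (S - (J \<union> K))"
      "insert x S - (J \<union> insert x K) = S - (J \<union> K)"
      "insert x S - (insert x J \<union> K) = S - (J \<union> K)"
      "insert x S - (insert x J \<union> insert x K) = S - (J \<union> K)"
      "sym_diff J (insert x K) = insert x (sym_diff J K)"
      "sym_diff (insert x J) K = insert x (sym_diff J K)"
      "sym_diff (insert x J) (insert x K) = sym_diff J K"
      using fin insert.hyps by auto
    have "x \<notin> sym_diff J K" "x \<notin> S - (J \<union> K)" "finite (sym_diff J K)" "finite (S - (J \<union> K))"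
      using fin insert.hyps by auto
    then show ?thesis
      unfolding w_def q_def sets using fin
      by (simp add: algebra_simps)
  qed
  have "(\<Sum>J\<in>Pow (insert x S). \<Sum>K\<in>Pow (insert x S). w (insert x S) J K)
      = (\<Sum>J\<in>Pow S. \<Sum>K\<in>Pow S. q * w S J K)"
    unfolding sum_Pow_insert[OF insert.hyps] sum.distrib[symmetric]
    using step by (intro sum.cong refl) blast
  also have "\<dots> = q * q ^ card S"
    using insert.IH by (simp add: w_def q_def sum_distrib_left[symmetric])
  finally show ?case
    using insert.hyps by (simp add: w_def q_def)
qed

text \<open>Multiplying by the denominator telescopes to \<open>fps_X\<close>; its constant term
  \<open>1\<close> makes it nonzero, so it can be cancelled.\<close>

lemma fps_X_times_geometric:
  fixes q :: "'a::field"
  shows "Abs_fps (\<lambda>n. if n = 0 then 0 else q ^ (n - 1)) = fps_X / (1 - fps_X * fps_const q)"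
proof -
  let ?F = "Abs_fps (\<lambda>n. if n = 0 then 0 else q ^ (n - 1))"
  let ?D = "1 - fps_X * fps_const q"
  have "?F * ?D = fps_X"
  proof (rule fps_ext)
    fix n
    have "?F * ?D = ?F - fps_X * (?F * fps_const q)"
      by (simp add: algebra_simps)
    then show "fps_nth (?F * ?D) n = fps_nth fps_X n"
      by (cases n; cases "n - 1") (auto simp: fps_X_nth)
  qed
  moreover have "fps_nth ?D 0 = 1" by simp
  then have "?D \<noteq> 0" by force
  ultimately show ?thesis
    by (metis nonzero_mult_div_cancel_right)
qed

theorem theorem4p1:
  fixes Y A B :: "'a::field"
  shows "M_gf Y A B = fps_X / (1 - fps_X * fps_const (1 + A * B + (A + B) * Y)) \<and>
         K_gf Y A B = fps_X / (1 - fps_X * fps_const (A * B + (A + B) * Y))"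
proof
  \<comment> \<open>This includes \<open>n = 0\<close>, where \<open>{1..<0}\<close> is empty and
    \<open>0 - 1 = 0\<close>, so both sides are \<open>1\<close>. Being unconditional, it rewrites
    under the binder of the series.\<close>
  have M: "(\<Sum>(\<alpha>, \<beta>) \<in> IntNC n \<times> IntNC n.
        Y ^ perm_len n (inv \<alpha> \<circ> \<beta>) * A ^ perm_len n \<alpha> * B ^ perm_len n \<beta>)
      = (1 + A * B + (A + B) * Y) ^ (n - 1)" for n
  proof -
    have "(\<Sum>(\<alpha>, \<beta>) \<in> IntNC n \<times> IntNC n.
          Y ^ perm_len n (inv \<alpha> \<circ> \<beta>) * A ^ perm_len n \<alpha> * B ^ perm_len n \<beta>)
        = (\<Sum>J\<in>Pow {1..<n}. \<Sum>K\<in>Pow {1..<n}.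
            Y ^ card (sym_diff J K) * A ^ card J * B ^ card K)"
      unfolding IntNC_eq sum.cartesian_product[symmetric] sum.reindex[OF inj_on_join_perm] o_def
      by (intro sum.cong refl)
        (simp only: Pow_iff perm_len_join_perm_quotient[unfolded o_def] perm_len_join_perm)
    \<comment> \<open>With \<open>c = 1\<close> every pair of subsets counts.\<close>
    also have "\<dots> = (1 + A * B + (A + B) * Y) ^ (n - 1)"
      using sum_Pow_Pow[of "{1..<n}" 1 Y A B] by simp
    finally show ?thesis .
  qed
  show "M_gf Y A B = fps_X / (1 - fps_X * fps_const (1 + A * B + (A + B) * Y))"
    unfolding M_gf_def M by (rule fps_X_times_geometric)
  have K: "(\<Sum>(\<alpha>, \<beta>) \<in> {(\<alpha>, \<beta>). \<alpha> \<in> KrInt n \<and> \<beta> \<in> KrInt n \<and> meet_KrInt n \<alpha> \<beta> = id}.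
        Y ^ perm_len n (inv \<alpha> \<circ> \<beta>) * A ^ perm_len n (inv \<alpha> \<circ> full_cycle n)
          * B ^ perm_len n (inv \<beta> \<circ> full_cycle n))
      = (A * B + (A + B) * Y) ^ (n - 1)" if n: "n \<ge> 1" for n
  proof -
    define kr where "kr J = kreweras n (join_perm n J)" for J
    define w where "w \<alpha> \<beta> = Y ^ perm_len n (inv \<alpha> \<circ> \<beta>) * A ^ perm_len n (inv \<alpha> \<circ> full_cycle n)
          * B ^ perm_len n (inv \<beta> \<circ> full_cycle n)" for \<alpha> \<beta>
    have KrInt: "KrInt n = kr ` Pow {1..<n}"
      by (simp add: KrInt_def IntNC_eq kr_def image_image)
    have inj: "inj_on kr (Pow {1..<n})"
      unfolding kr_def by (rule inj_on_kreweras_join_perm[OF n])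
    \<comment> \<open>The meet condition becomes a power of \<open>0\<close>, equal to
      \<open>1\<close> if \<open>J \<union> K = {1..<n}\<close> and to \<open>0\<close> otherwise,
      so the sum can run over all pairs.\<close>
    have weight: "(if meet_KrInt n (kr J) (kr K) = id then w (kr J) (kr K) else 0)
        = 0 ^ card ({1..<n} - (J \<union> K)) * (Y ^ card (sym_diff J K) * A ^ card J * B ^ card K)"
      if "J \<in> Pow {1..<n}" "K \<in> Pow {1..<n}" for J K
    proof -
      have JK: "J \<subseteq> {1..<n}" "K \<subseteq> {1..<n}" using that by auto
      have "meet_KrInt n (kr J) (kr K) = id \<longleftrightarrow> {1..<n} - (J \<union> K) = {}"
        using JK meet_KrInt_kreweras[OF n JK] kreweras_eq_id_iff[OF n, of "J \<union> K"]
        by (auto simp: kr_def)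
      also have "\<dots> \<longleftrightarrow> card ({1..<n} - (J \<union> K)) = 0"
        by (simp only: card_0_eq finite_Diff finite_atLeastLessThan)
      finally show ?thesis
        using JK by (simp add: w_def kr_def perm_len_kreweras_quotient[OF n]
            perm_len_inv_kreweras_comp_full_cycle[OF n] power_0_left)
    qed
    have fin: "finite (KrInt n \<times> KrInt n)"
      by (simp add: KrInt)
    have "(\<Sum>(\<alpha>, \<beta>) \<in> {(\<alpha>, \<beta>). \<alpha> \<in> KrInt n \<and> \<beta> \<in> KrInt n \<and> meet_KrInt n \<alpha> \<beta> = id}. w \<alpha> \<beta>)
        = (\<Sum>(\<alpha>, \<beta>) \<in> KrInt n \<times> KrInt n. if meet_KrInt n \<alpha> \<beta> = id then w \<alpha> \<beta> else 0)"
      using fin by (intro sum.mono_neutral_cong_left) (auto split: if_splits)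
    also have "\<dots> = (\<Sum>J\<in>Pow {1..<n}. \<Sum>K\<in>Pow {1..<n}.
        if meet_KrInt n (kr J) (kr K) = id then w (kr J) (kr K) else 0)"
      unfolding KrInt sum.cartesian_product[symmetric] sum.reindex[OF inj] by simp
    also have "\<dots> = (\<Sum>J\<in>Pow {1..<n}. \<Sum>K\<in>Pow {1..<n}.
        0 ^ card ({1..<n} - (J \<union> K)) * (Y ^ card (sym_diff J K) * A ^ card J * B ^ card K))"
      by (intro sum.cong refl weight)
    also have "\<dots> = (A * B + (A + B) * Y) ^ (n - 1)"
      using sum_Pow_Pow[of "{1..<n}" 0 Y A B] by simp
    finally show ?thesis by (simp add: w_def)
  qed
  \<comment> \<open>The coefficient at \<open>0\<close> is set separately, which supplies
    \<open>n \<ge> 1\<close> wherever \<open>K\<close> is applied.\<close>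
  have "K_gf Y A B = Abs_fps (\<lambda>n. if n = 0 then 0 else (A * B + (A + B) * Y) ^ (n - 1))"
    unfolding K_gf_def by (intro arg_cong[of _ _ Abs_fps] ext) (simp add: K del: power_Suc)
  then show "K_gf Y A B = fps_X / (1 - fps_X * fps_const (A * B + (A + B) * Y))"
    by (simp only: fps_X_times_geometric)
qed

end
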